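(* Let $\widehat{LME}_{i,t}=\hat p_{\pi,i,t}+\hat p_o\hat\pi_{i,t}$ and $\widehat{LMP}_{i,t}=\hat\pi_{i,t}$ be derived from an arbitrary pair of optimal primal and Lagrangian dual solutions of the Combined Storage Model, and let $\hat P^{S+},\hat P^{S-}$ be the storage variables of that optimal primal solution. Then for every storage resource $s\in S$, $(\hat P^{S+}_s,\hat P^{S-}_s)$ is an optimal solution of the decentralized storage problem of $s$ with pricing parameters $\widehat{LMP}$ and $\widehat{LME}$; that is, $(\hat P^{S+}_s,\hat P^{S-}_s)\in P^{S*}_s$ and it minimizes $\sum_{t\in T}\widehat{LME}_{s,t}(P^{S+}_{s,t}-P^{S-}_{s,t})$ over $(P^{S+}_s,P^{S-}_s)\in P^{S*}_s$.
   Context: **Data.** $N$ finite set of nodes; $G$ finite set of generators, $G_i$ those at node $i$; $S$ finite set of storage resources, $S_i$ those at node $i$ (each generator and storage resource is at exactly one node); $L$ finite set of directed lines $\ell=(i,j)$ with admittance $B_\ell=B_{ij}$; $T=\{1,\dots,m\}$ the dispatch periods. Real parameters: $c_g,\sigma_g,P^{min}_g,P^{max}_g,f^{max}_\ell,E^{max}_s,P^D_{i,t}$ and efficiency $\eta\in(0,1]$. A nodal quantity subscripted by a generator or storage resource means its value at the node where that resource is located. **Storage DC-OPF.** Minimize $\sum_{t\in T}\sum_{g\in G}c_gP^G_{g,t}$ over $(P^G,\theta,f,P^{S+},P^{S-},E)$ subject to, for all $t\in T$: $B_{ij}(\theta_{i,t}-\theta_{j,t})-f_{\ell,t}=0$ for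 $\ell=(i,j)\in L$ $[z_{\ell,t}]$; $\sum_{g\in G_i}P^G_{g,t}-\sum_{\ell=(i,j)\in L}f_{\ell,t}+\sum_{\ell=(j,i)\in L}f_{\ell,t}-\sum_{s\in S_i}(P^{S+}_{s,t}-P^{S-}_{s,t})=P^D_{i,t}$ for $i\in N$ $[\pi_{i,t}]$; $f_{\ell,t}\le f^{max}_\ell$ $[\rho^+_{\ell,t}]$; $f_{\ell,t}\ge-f^{max}_\ell$ $[\rho^-_{\ell,t}]$; $P^G_{g,t}\le P^{max}_g$ $[\gamma^+_{g,t}]$; $P^G_{g,t}\ge P^{min}_g$ $[\gamma^-_{g,t}]$; $E_{s,t}+\eta P^{S+}_{s,t}-\frac1\eta P^{S-}_{s,t}-E_{s,t+1}=0$ for $s\in S$ $[\alpha_{s,t}]$; $P^{S+}_{s,t},P^{S-}_{s,t}\ge0$; and $0\le E_{s,t}\le E^{max}_s$ for all periods $t=2,\dots,m+1$ [$\beta^-_{s,t}$ for $\ge0$, $\beta^+_{s,t}$ for $\le E^{max}_s$], where $E_{s,1}=0$. **Combined Storage Model.** Minimize $\sum_{t\in T}\sum_{g\in G}\sigma_gP^G_{g,t}$ over the storage DC-OPF variables and $(\pi,\gamma^\pm,\rho^\pm,z,\alpha,\beta^\pm,\tau^\pm)$ subject to all constraints of the storage DC-OPF, its dual constraints (for $t\in T$): $\gamma^+_{g,t}+\gamma^-_{g,t}+\sum_{i\mid g\in G_i}\pi_{i,t}=c_g$; $-z_{\ell,t}+\rho^+_{\ell,t}+\rho^-_{\ell,t}-\pi_{i,t}+\pi_{j,t}=0$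 for $\ell=(i,j)$; $\sum_{\ell=(i,j)\in L}B_\ell z_{\ell,t}-\sum_{\ell=(j,i)\in L}B_\ell z_{\ell,t}=0$ for $i\in N$; $-\sum_{i\mid s\in S_i}\pi_{i,t}+\eta\alpha_{s,t}+\tau^+_{s,t}=0$; $\sum_{i\mid s\in S_i}\pi_{i,t}-\frac1\eta\alpha_{s,t}+\tau^-_{s,t}=0$; $\beta^+_{s,t}+\beta^-_{s,t}+\alpha_{s,t}-\alpha_{s,t-1}=0$ for $t=2,\dots,m+1$ with the convention $\alpha_{s,m+1}=0$; $\rho^+,\gamma^+,\beta^+\le0$; $\rho^-,\gamma^-,\beta^-,\tau^+,\tau^-\ge0$; and the strong duality constraint $$\sum_{t\in T}\Big(\sum_gc_gP^G_{g,t}-\sum_iP^D_{i,t}\pi_{i,t}-\sum_\ell(\rho^+_{\ell,t}-\rho^-_{\ell,t})f^{max}_\ell-\sum_g(\gamma^+_{g,t}P^{max}_g+\gamma^-_{g,t}P^{min}_g)\Big)-\sum_{s}\sum_{t=2}^{m+1}\beta^+_{s,t}E^{max}_s\le0.$$ **Multipliers.** $p$ denotes a Lagrangian dual solution of this linear program, with Lagrangian equal to the objective minus the sum of multiplier times (left side minus right side), so multipliers of $\le$ constraints are $\le0$, of $\ge$ constraints $\ge0$, of equalities free. $p_{\pi,i,t}$ is the multiplier of the flow balance constraint and $p_o$ that of the strong duality constraint. **Decentralized storage problem** (for $s$, given $LMP$ and $LME$): let $P^{S*}_s$ be the set of $(P^{S+}_s,P^{S-}_s)$ which, together with some $E_s$,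 minimize $\sum_{t\in T}LMP_{s,t}(P^{S+}_{s,t}-P^{S-}_{s,t})$ subject to $P^{S+}_s,P^{S-}_s,E_s\ge0$, $E_{s,1}=0$, $E_{s,t}\le E^{max}_s$ for $t=2,\dots,m+1$, and $E_{s,t}+\eta P^{S+}_{s,t}-\frac1\eta P^{S-}_{s,t}-E_{s,t+1}=0$ for $t\in T$; then solve $\min_{(P^{S+}_s,P^{S-}_s)\in P^{S*}_s}\sum_{t\in T}LME_{s,t}(P^{S+}_{s,t}-P^{S-}_{s,t})$. *)

theory Defs
  imports Complex_Main "HOL-Library.Extended_Real"
begin

section \<open>Constrained programs and their Lagrangian duals\<close>

datatype 'x constr =
    Eq "'x \<Rightarrow> real" real
  | Le "'x \<Rightarrow> real" real
  | Ge "'x \<Rightarrow> real" real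

primrec holds :: "'x constr \<Rightarrow> 'x \<Rightarrow> bool" where
  "holds (Eq a b) x \<longleftrightarrow> a x = b"
| "holds (Le a b) x \<longleftrightarrow> a x \<le> b"
| "holds (Ge a b) x \<longleftrightarrow> a x \<ge> b"

primrec residual :: "'x constr \<Rightarrow> 'x \<Rightarrow> real" where
  "residual (Eq a b) x = a x - b"
| "residual (Le a b) x = a x - b"
| "residual (Ge a b) x = a x - b"

primrec multiplier_sign :: "'x constr \<Rightarrow> real \<Rightarrow> bool" where
  "multiplier_sign (Eq a b) y \<longleftrightarrow> True"
| "multiplier_sign (Le a b) y \<longleftrightarrow> y \<le> 0"
| "multiplier_sign (Ge a b) y \<longleftrightarrow> y \<ge> 0"

text \<open>A minimization program consists of an objective \<open>h\<close>, a finite set \<open>K\<close> of constraint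
  indices and a constraint \<open>C k\<close> for every \<open>k \<in> K\<close>.\<close>

definition feasible :: "'k set \<Rightarrow> ('k \<Rightarrow> 'x constr) \<Rightarrow> 'x \<Rightarrow> bool" where
  "feasible K C x \<longleftrightarrow> (\<forall>k\<in>K. holds (C k) x)"

definition primal_optimal :: "('x \<Rightarrow> real) \<Rightarrow> 'k set \<Rightarrow> ('k \<Rightarrow> 'x constr) \<Rightarrow> 'x \<Rightarrow> bool" where
  "primal_optimal h K C = is_arg_min h (feasible K C)"

definition lagrangian ::
  "('x \<Rightarrow> real) \<Rightarrow> 'k set \<Rightarrow> ('k \<Rightarrow> 'x constr) \<Rightarrow> 'x \<Rightarrow> ('k \<Rightarrow> real) \<Rightarrow> real" where
  "lagrangian h K C x p = h x - (\<Sum>k\<in>K. p k * residual (C k) x)"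

definition dual_function ::
  "('x \<Rightarrow> real) \<Rightarrow> 'k set \<Rightarrow> ('k \<Rightarrow> 'x constr) \<Rightarrow> ('k \<Rightarrow> real) \<Rightarrow> ereal" where
  "dual_function h K C p = (INF x. ereal (lagrangian h K C x p))"

definition lagrangian_dual_optimal ::
  "('x \<Rightarrow> real) \<Rightarrow> 'k set \<Rightarrow> ('k \<Rightarrow> 'x constr) \<Rightarrow> ('k \<Rightarrow> real) \<Rightarrow> bool" where
  "lagrangian_dual_optimal h K C =
     is_arg_max (dual_function h K C) (\<lambda>p. \<forall>k\<in>K. multiplier_sign (C k) (p k))"

section \<open>Network data\<close>

text \<open>Lines are ordered pairs of nodes; \<open>gen_node\<close> and \<open>stor_node\<close> give the unique location of a
  generator or storage resource.\<close>

record ('n, 'g, 's) network =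
  nodes :: "'n set"
  gens :: "'g set"
  stors :: "'s set"
  lines :: "('n \<times> 'n) set"
  gen_node :: "'g \<Rightarrow> 'n"
  stor_node :: "'s \<Rightarrow> 'n"
  horizon :: nat
  admittance :: "'n \<times> 'n \<Rightarrow> real"
  gen_cost :: "'g \<Rightarrow> real"
  gen_emission :: "'g \<Rightarrow> real"       \<comment> \<open>\<open>\<sigma>\<close>\<close>
  gen_min :: "'g \<Rightarrow> real"
  gen_max :: "'g \<Rightarrow> real"
  flow_max :: "'n \<times> 'n \<Rightarrow> real"
  level_max :: "'s \<Rightarrow> real"
  demand :: "'n \<Rightarrow> nat \<Rightarrow> real"
  eta :: real

definition wf_network :: "('n, 'g, 's) network \<Rightarrow> bool" where
  "wf_network D \<longleftrightarrow>
     finite (nodes D) \<and> finite (gens D) \<and> finite (stors D) \<and> finite (lines D) \<and>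
     gen_node D ` gens D \<subseteq> nodes D \<and> stor_node D ` stors D \<subseteq> nodes D \<and>
     lines D \<subseteq> nodes D \<times> nodes D \<and> 0 < eta D \<and> eta D \<le> 1"

definition gens_at :: "('n, 'g, 's) network \<Rightarrow> 'n \<Rightarrow> 'g set" where
  "gens_at D i = {g \<in> gens D. gen_node D g = i}"

definition stors_at :: "('n, 'g, 's) network \<Rightarrow> 'n \<Rightarrow> 's set" where
  "stors_at D i = {s \<in> stors D. stor_node D s = i}"

definition lines_from :: "('n, 'g, 's) network \<Rightarrow> 'n \<Rightarrow> ('n \<times> 'n) set" where
  "lines_from D i = {l \<in> lines D. fst l = i}"

definition lines_to :: "('n, 'g, 's) network \<Rightarrow> 'n \<Rightarrow> ('n \<times> 'n) set" where
  "lines_to D i = {l \<in> lines D. snd l = i}"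

abbreviation periods :: "('n, 'g, 's) network \<Rightarrow> nat set" where
  "periods D \<equiv> {1..horizon D}"

abbreviation level_periods :: "('n, 'g, 's) network \<Rightarrow> nat set" where
  "level_periods D \<equiv> {2..horizon D + 1}"

section \<open>Combined storage model\<close>

text \<open>Only the components at nodes, lines, generators, storage resources and periods of the
  network occur in the objective and the constraints.\<close>

record ('n, 'g, 's) csm_point =
  gen_out :: "'g \<Rightarrow> nat \<Rightarrow> real"
  angle :: "'n \<Rightarrow> nat \<Rightarrow> real"
  flow :: "'n \<times> 'n \<Rightarrow> nat \<Rightarrow> real"
  charge :: "'s \<Rightarrow> nat \<Rightarrow> real"              \<comment> \<open>\<open>P\<^sup>S\<^sup>+\<close>\<close>
  discharge :: "'s \<Rightarrow> nat \<Rightarrow> real"           \<comment> \<open>\<open>P\<^sup>S\<^sup>-\<close>\<close>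
  level :: "'s \<Rightarrow> nat \<Rightarrow> real"               \<comment> \<open>\<open>E\<close>\<close>
  price :: "'n \<Rightarrow> nat \<Rightarrow> real"               \<comment> \<open>\<open>\<pi>\<close>, multiplier of flow balance\<close>
  gamma_up :: "'g \<Rightarrow> nat \<Rightarrow> real"
  gamma_lo :: "'g \<Rightarrow> nat \<Rightarrow> real"
  rho_up :: "'n \<times> 'n \<Rightarrow> nat \<Rightarrow> real"
  rho_lo :: "'n \<times> 'n \<Rightarrow> nat \<Rightarrow> real"
  zeta :: "'n \<times> 'n \<Rightarrow> nat \<Rightarrow> real"
  alpha :: "'s \<Rightarrow> nat \<Rightarrow> real"
  beta_up :: "'s \<Rightarrow> nat \<Rightarrow> real"
  beta_lo :: "'s \<Rightarrow> nat \<Rightarrow> real"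
  tau_ch :: "'s \<Rightarrow> nat \<Rightarrow> real"
  tau_dis :: "'s \<Rightarrow> nat \<Rightarrow> real"

datatype ('n, 'g, 's) csm_index =
  \<comment> \<open>constraints of the storage DC-OPF\<close>
    Line_flow "'n \<times> 'n" nat | Balance 'n nat
  | Flow_up "'n \<times> 'n" nat | Flow_lo "'n \<times> 'n" nat
  | Gen_up 'g nat | Gen_lo 'g nat
  | Storage_dyn 's nat | Charge_nonneg 's nat | Discharge_nonneg 's nat
  | Level_init 's | Level_lo 's nat | Level_up 's nat
  \<comment> \<open>constraints of its dual, named after the primal variable they belong to\<close>
  | Dual_gen 'g nat | Dual_flow "'n \<times> 'n" nat | Dual_angle 'n nat
  | Dual_charge 's nat | Dual_discharge 's nat | Dual_level 's nat
  | Sign_rho_up "'n \<times> 'n" nat | Sign_rho_lo "'n \<times> 'n" nat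
  | Sign_gamma_up 'g nat | Sign_gamma_lo 'g nat
  | Sign_beta_up 's nat | Sign_beta_lo 's nat
  | Sign_tau_ch 's nat | Sign_tau_dis 's nat
  | Strong_duality

definition csm_indices :: "('n, 'g, 's) network \<Rightarrow> ('n, 'g, 's) csm_index set" where
  "csm_indices D =
     (\<Union>l\<in>lines D. \<Union>t\<in>periods D.
        {Line_flow l t, Flow_up l t, Flow_lo l t, Dual_flow l t, Sign_rho_up l t, Sign_rho_lo l t}) \<union>
     (\<Union>i\<in>nodes D. \<Union>t\<in>periods D. {Balance i t, Dual_angle i t}) \<union>
     (\<Union>g\<in>gens D. \<Union>t\<in>periods D.
        {Gen_up g t, Gen_lo g t, Dual_gen g t, Sign_gamma_up g t, Sign_gamma_lo g t}) \<union>
     (\<Union>s\<in>stors D. \<Union>t\<in>periods D.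
        {Storage_dyn s t, Charge_nonneg s t, Discharge_nonneg s t,
         Dual_charge s t, Dual_discharge s t, Sign_tau_ch s t, Sign_tau_dis s t}) \<union>
     (\<Union>s\<in>stors D. \<Union>t\<in>level_periods D.
        {Level_lo s t, Level_up s t, Dual_level s t, Sign_beta_up s t, Sign_beta_lo s t}) \<union>
     (\<Union>s\<in>stors D. {Level_init s}) \<union>
     {Strong_duality}"

definition alpha_ext ::
  "('n, 'g, 's) network \<Rightarrow> ('n, 'g, 's) csm_point \<Rightarrow> 's \<Rightarrow> nat \<Rightarrow> real" where
  "alpha_ext D x s t = (if t = horizon D + 1 then 0 else alpha x s t)"

primrec csm_constr ::
  "('n, 'g, 's) network \<Rightarrow> ('n, 'g, 's) csm_index \<Rightarrow> ('n, 'g, 's) csm_point constr" where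
  "csm_constr D (Line_flow l t) =
     Eq (\<lambda>x. admittance D l * (angle x (fst l) t - angle x (snd l) t) - flow x l t) 0"
| "csm_constr D (Balance i t) =
     Eq (\<lambda>x. (\<Sum>g\<in>gens_at D i. gen_out x g t)
           - (\<Sum>l\<in>lines_from D i. flow x l t) + (\<Sum>l\<in>lines_to D i. flow x l t)
           - (\<Sum>s\<in>stors_at D i. charge x s t - discharge x s t)) (demand D i t)"
| "csm_constr D (Flow_up l t) = Le (\<lambda>x. flow x l t) (flow_max D l)"
| "csm_constr D (Flow_lo l t) = Ge (\<lambda>x. flow x l t) (- flow_max D l)"
| "csm_constr D (Gen_up g t) = Le (\<lambda>x. gen_out x g t) (gen_max D g)"
| "csm_constr D (Gen_lo g t) = Ge (\<lambda>x. gen_out x g t) (gen_min D g)"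
| "csm_constr D (Storage_dyn s t) =
     Eq (\<lambda>x. level x s t + eta D * charge x s t - 1 / eta D * discharge x s t
           - level x s (t + 1)) 0"
| "csm_constr D (Charge_nonneg s t) = Ge (\<lambda>x. charge x s t) 0"
| "csm_constr D (Discharge_nonneg s t) = Ge (\<lambda>x. discharge x s t) 0"
| "csm_constr D (Level_init s) = Eq (\<lambda>x. level x s 1) 0"
| "csm_constr D (Level_lo s t) = Ge (\<lambda>x. level x s t) 0"
| "csm_constr D (Level_up s t) = Le (\<lambda>x. level x s t) (level_max D s)"
| "csm_constr D (Dual_gen g t) =
     Eq (\<lambda>x. gamma_up x g t + gamma_lo x g t
           + (\<Sum>i\<in>{i \<in> nodes D. g \<in> gens_at D i}. price x i t)) (gen_cost D g)"
| "csm_constr D (Dual_flow l t) =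
     Eq (\<lambda>x. - zeta x l t + rho_up x l t + rho_lo x l t
           - price x (fst l) t + price x (snd l) t) 0"
| "csm_constr D (Dual_angle i t) =
     Eq (\<lambda>x. (\<Sum>l\<in>lines_from D i. admittance D l * zeta x l t)
           - (\<Sum>l\<in>lines_to D i. admittance D l * zeta x l t)) 0"
| "csm_constr D (Dual_charge s t) =
     Eq (\<lambda>x. - (\<Sum>i\<in>{i \<in> nodes D. s \<in> stors_at D i}. price x i t)
           + eta D * alpha x s t + tau_ch x s t) 0"
| "csm_constr D (Dual_discharge s t) =
     Eq (\<lambda>x. (\<Sum>i\<in>{i \<in> nodes D. s \<in> stors_at D i}. price x i t)
           - 1 / eta D * alpha x s t + tau_dis x s t) 0"
| "csm_constr D (Dual_level s t) =
     Eq (\<lambda>x. beta_up x s t + beta_lo x s t + alpha_ext D x s t - alpha_ext D x s (t - 1)) 0"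
| "csm_constr D (Sign_rho_up l t) = Le (\<lambda>x. rho_up x l t) 0"
| "csm_constr D (Sign_rho_lo l t) = Ge (\<lambda>x. rho_lo x l t) 0"
| "csm_constr D (Sign_gamma_up g t) = Le (\<lambda>x. gamma_up x g t) 0"
| "csm_constr D (Sign_gamma_lo g t) = Ge (\<lambda>x. gamma_lo x g t) 0"
| "csm_constr D (Sign_beta_up s t) = Le (\<lambda>x. beta_up x s t) 0"
| "csm_constr D (Sign_beta_lo s t) = Ge (\<lambda>x. beta_lo x s t) 0"
| "csm_constr D (Sign_tau_ch s t) = Ge (\<lambda>x. tau_ch x s t) 0"
| "csm_constr D (Sign_tau_dis s t) = Ge (\<lambda>x. tau_dis x s t) 0"
| "csm_constr D Strong_duality =
     Le (\<lambda>x. (\<Sum>t\<in>periods D.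
               (\<Sum>g\<in>gens D. gen_cost D g * gen_out x g t)
             - (\<Sum>i\<in>nodes D. demand D i t * price x i t)
             - (\<Sum>l\<in>lines D. (rho_up x l t - rho_lo x l t) * flow_max D l)
             - (\<Sum>g\<in>gens D. gamma_up x g t * gen_max D g + gamma_lo x g t * gen_min D g))
           - (\<Sum>s\<in>stors D. \<Sum>t\<in>level_periods D. beta_up x s t * level_max D s)) 0"

definition csm_objective :: "('n, 'g, 's) network \<Rightarrow> ('n, 'g, 's) csm_point \<Rightarrow> real" where
  "csm_objective D x = (\<Sum>t\<in>periods D. \<Sum>g\<in>gens D. gen_emission D g * gen_out x g t)"

definition csm_optimal :: "('n, 'g, 's) network \<Rightarrow> ('n, 'g, 's) csm_point \<Rightarrow> bool" where
  "csm_optimal D = primal_optimal (csm_objective D) (csm_indices D) (csm_constr D)"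

definition csm_dual_optimal ::
  "('n, 'g, 's) network \<Rightarrow> (('n, 'g, 's) csm_index \<Rightarrow> real) \<Rightarrow> bool" where
  "csm_dual_optimal D = lagrangian_dual_optimal (csm_objective D) (csm_indices D) (csm_constr D)"

section \<open>Decentralized storage problem\<close>

text \<open>A schedule of a single storage resource is a pair of its charging and discharging decisions;
  prices are nodal and are evaluated at the node of the resource.\<close>

definition schedule_feasible ::
  "('n, 'g, 's) network \<Rightarrow> 's \<Rightarrow> (nat \<Rightarrow> real) \<times> (nat \<Rightarrow> real) \<Rightarrow> (nat \<Rightarrow> real) \<Rightarrow> bool" where
  "schedule_feasible D s y E \<longleftrightarrow>
     (\<forall>t\<in>periods D. fst y t \<ge> 0 \<and> snd y t \<ge> 0) \<and>
     (\<forall>t\<in>{1..horizon D + 1}. E t \<ge> 0) \<and> E 1 = 0 \<and>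
     (\<forall>t\<in>level_periods D. E t \<le> level_max D s) \<and>
     (\<forall>t\<in>periods D. E t + eta D * fst y t - 1 / eta D * snd y t - E (t + 1) = 0)"

definition schedule_value ::
  "('n, 'g, 's) network \<Rightarrow> 's \<Rightarrow> ('n \<Rightarrow> nat \<Rightarrow> real) \<Rightarrow> (nat \<Rightarrow> real) \<times> (nat \<Rightarrow> real) \<Rightarrow> real" where
  "schedule_value D s q y = (\<Sum>t\<in>periods D. q (stor_node D s) t * (fst y t - snd y t))"

definition cost_optimal_schedules ::
  "('n, 'g, 's) network \<Rightarrow> ('n \<Rightarrow> nat \<Rightarrow> real) \<Rightarrow> 's \<Rightarrow> ((nat \<Rightarrow> real) \<times> (nat \<Rightarrow> real)) set" where
  "cost_optimal_schedules D LMP s =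
     {y. is_arg_min (schedule_value D s LMP) (\<lambda>y. \<exists>E. schedule_feasible D s y E) y}"

definition decentralized_optimal ::
  "('n, 'g, 's) network \<Rightarrow> ('n \<Rightarrow> nat \<Rightarrow> real) \<Rightarrow> ('n \<Rightarrow> nat \<Rightarrow> real) \<Rightarrow> 's \<Rightarrow>
   (nat \<Rightarrow> real) \<times> (nat \<Rightarrow> real) \<Rightarrow> bool" where
  "decentralized_optimal D LMP LME s =
     is_arg_min (schedule_value D s LME) (\<lambda>y. y \<in> cost_optimal_schedules D LMP s)"

end

theory Submission
  imports Defs
begin

text \<open>
  The bilevel optimality of a schedule splits into two single-level statements about the storage
  resource \<open>s\<close>, both over all feasible schedules of \<open>s\<close>.

  The schedule is cost-optimal at the nodal prices. The feasible set of the combined model contains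
  the dual constraints of the storage DC-OPF, and those attached to \<open>s\<close> form a dual certificate of
  the cost minimization of \<open>s\<close>: every feasible schedule costs at least \<open>\<Sum>\<^sub>t \<beta>\<^sup>+\<^sub>s\<^sub>t E\<^sup>m\<^sup>a\<^sup>x\<^sub>s\<close>
  (\<open>schedule_weak_duality\<close>). The strong duality constraint forces the sum over all resources of
  these inequalities to be tight at the given point, so each of them is tight
  (\<open>csm_schedule_cost_le_level_rent\<close>).

  The schedule is also optimal when the price is the multiplier \<open>p\<^sub>\<pi>\<close> of the balance constraint
  (\<open>balance_multiplier_optimal\<close>). Replace the schedule of \<open>s\<close> in the optimal point by any other
  feasible one. The objective is unchanged, and so is every constraint that does not belong to \<open>s\<close>,
  except the balances at the node of \<open>s\<close>; in particular the strong duality constraint contains no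
  charging, discharging or level variable. Since the model is a linear program, there is no duality
  gap, and so the Lagrangian at \<open>p\<close> is nowhere below the optimal value. At the modified point this
  says exactly that the net charge of \<open>s\<close>, valued at \<open>p\<^sub>\<pi>\<close>, has not decreased.

  On the cost-optimal schedules the term \<open>p\<^sub>o \<pi>\<close> of the locational marginal emission contributes a
  constant, because they all have the same cost at the prices \<open>\<pi>\<close>. What is left is \<open>p\<^sub>\<pi>\<close>, and the
  second statement gives the claim.

  Absence of a duality gap is derived from Farkas' lemma (\<open>farkas\<close>), proved by elimination of one
  inequality at a time, which makes no reference to dimension or topology.
\<close>

section \<open>Farkas' lemma\<close>

text \<open>The vectors are given by the values of the relevant functionals on them, so a linear space
  together with its functionals is just a set of functions closed under linear combinations; in
  this form the lemma applies to decision variables of any type. In the induction step, if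
  constraint \<open>k\<close> is really needed, some \<open>v\<close> has a negative objective and satisfies all the
  constraints but \<open>k\<close>. Projecting along \<open>v\<close> onto the vectors with coordinate \<open>k\<close> zero removes
  constraint \<open>k\<close>, and the signs of \<open>v\<close> make the multiplier of \<open>k\<close> that results nonnegative.\<close>

lemma farkas:
  fixes W :: "('i \<Rightarrow> real) set" and obj :: 'i
  assumes "finite A"
    and "\<And>u v r. u \<in> W \<Longrightarrow> v \<in> W \<Longrightarrow> (\<lambda>i. u i + r * v i) \<in> W"
    and "\<And>w. w \<in> W \<Longrightarrow> \<forall>i\<in>A. w i \<ge> 0 \<Longrightarrow> w obj \<ge> 0"
  shows "\<exists>c. (\<forall>i\<in>A. c i \<ge> 0) \<and> (\<forall>w\<in>W. w obj = (\<Sum>i\<in>A. c i * w i))"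
  using assms
proof (induction A arbitrary: W rule: finite_induct)
  case empty
  have "w obj = 0" if w: "w \<in> W" for w
  proof -
    have "(\<lambda>i. w i + (-2) * w i) \<in> W"
      using empty(1) w by blast
    \<comment> \<open>Both \<open>w\<close> and \<open>- w\<close> lie in \<open>W\<close>.\<close>
    from empty(2)[OF this] empty(2)[OF w] show ?thesis by simp
  qed
  then show ?case by simp
next
  case (insert k A)
  note comb = insert.prems(1) and pos = insert.prems(2)
  show ?case
  proof (cases "\<forall>w\<in>W. (\<forall>i\<in>A. w i \<ge> 0) \<longrightarrow> w obj \<ge> 0")
    case True
    with insert.IH[OF comb] obtain c
      where c: "\<forall>i\<in>A. c i \<ge> 0" "\<forall>w\<in>W. w obj = (\<Sum>i\<in>A. c i * w i)" by blast
    have "(\<Sum>i\<in>A. (c(k := 0)) i * w i) = (\<Sum>i\<in>A. c i * w i)" for w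
      by (rule sum.cong) (use insert.hyps in auto)
    with c insert.hyps show ?thesis
      by (intro exI[of _ "c(k := 0)"]) auto
  next
    case False
    then obtain v where v: "v \<in> W" "\<forall>i\<in>A. v i \<ge> 0" "v obj < 0" by force
    with pos[of v] have vk: "v k < 0" by force
    define V where "V = {w \<in> W. w k = 0}"
    have "\<exists>c. (\<forall>i\<in>A. c i \<ge> 0) \<and> (\<forall>w\<in>V. w obj = (\<Sum>i\<in>A. c i * w i))"
      by (rule insert.IH) (use comb pos in \<open>auto simp: V_def\<close>)
    then obtain c where c: "\<forall>i\<in>A. c i \<ge> 0" "\<forall>w\<in>V. w obj = (\<Sum>i\<in>A. c i * w i)" by blast
    define ck where "ck = (v obj - (\<Sum>i\<in>A. c i * v i)) / v k"
    have "(\<Sum>i\<in>A. c i * v i) \<ge> 0"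
      using c(1) v(2) by (intro sum_nonneg) auto
    then have ck: "ck \<ge> 0"
      using v(3) vk by (auto simp: ck_def intro!: divide_nonpos_neg)
    have rep: "w obj = ck * w k + (\<Sum>i\<in>A. c i * w i)" if w: "w \<in> W" for w
    proof -
      \<comment> \<open>Shifting \<open>w\<close> along \<open>v\<close> annihilates coordinate \<open>k\<close>.\<close>
      define r where "r = - w k / v k"
      have "(\<lambda>i. w i + r * v i) \<in> V"
        using comb[OF w v(1), of r] vk by (auto simp: V_def r_def)
      with c(2) have "w obj + r * v obj = (\<Sum>i\<in>A. c i * (w i + r * v i))" by auto
      also have "\<dots> = (\<Sum>i\<in>A. c i * w i) + r * (\<Sum>i\<in>A. c i * v i)"
        by (simp add: algebra_simps sum.distrib sum_distrib_left)
      finally have "w obj = (\<Sum>i\<in>A. c i * w i) - r * (v obj - (\<Sum>i\<in>A. c i * v i))"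
        by (simp add: algebra_simps)
      then show ?thesis by (simp add: r_def ck_def)
    qed
    have "(\<Sum>i\<in>A. (c(k := ck)) i * w i) = (\<Sum>i\<in>A. c i * w i)" for w
      by (rule sum.cong) (use insert.hyps in auto)
    with rep c(1) ck insert.hyps show ?thesis
      by (intro exI[of _ "c(k := ck)"]) auto
  qed
qed

section \<open>Strong duality for linear programs\<close>

lemma multiplier_times_residual_nonneg:
  assumes "multiplier_sign c q" "holds c y"
  shows "q * residual c y \<ge> 0"
  using assms by (cases c) (auto intro: mult_nonpos_nonpos)

text \<open>An optimal solution minimizes the objective also to first order: no direction that respects
  the constraints active at \<open>x\<close> decreases \<open>h\<close>, since a short enough step along it stays feasible.
  Farkas' lemma then writes the variation of \<open>h\<close> as a combination of variations of active
  residuals. Because these residuals vanish at \<open>x\<close>, the Lagrangian at the multipliers found is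
  constant. The affine structure enters only through a function \<open>line\<close>, where \<open>line r y z\<close> stands
  for the point \<open>(1 - r) y + r z\<close>.\<close>

lemma primal_optimal_has_certificate:
  fixes line :: "real \<Rightarrow> 'x \<Rightarrow> 'x \<Rightarrow> 'x"
  assumes "finite K" and opt: "primal_optimal h K C x"
    and h: "\<And>r y z. h (line r y z) = (1 - r) * h y + r * h z"
    and C: "\<And>r y z k. k \<in> K \<Longrightarrow>
      residual (C k) (line r y z) = (1 - r) * residual (C k) y + r * residual (C k) z"
  obtains q where "\<forall>k\<in>K. multiplier_sign (C k) (q k)" "\<And>y. lagrangian h K C y q = h x"
proof -
  from opt have feas: "\<And>k. k \<in> K \<Longrightarrow> holds (C k) x"
    and least: "\<And>y. (\<And>k. k \<in> K \<Longrightarrow> holds (C k) y) \<Longrightarrow> h x \<le> h y"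
    by (force simp: primal_optimal_def is_arg_min_def feasible_def)+
  define R where "R k y = (if k \<in> K then residual (C k) y else 0)" for k y
  have R: "R k (line r y z) = (1 - r) * R k y + r * R k z" for k r y z
    by (simp add: R_def C)
  \<comment> \<open>A pair \<open>(k, e)\<close> is an active constraint oriented so that feasible directions increase
    \<open>e\<close> times its residual; equalities occur with both orientations.\<close>
  define A where "A = {(k, e) \<in> K \<times> {1, -1}. multiplier_sign (C k) e \<and> R k x = 0}"
  have [simp]: "finite A"
    by (rule finite_subset[of _ "K \<times> {1, -1}"]) (use \<open>finite K\<close> in \<open>auto simp: A_def\<close>)
  define \<phi> where "\<phi> y = (\<lambda>i. case i of None \<Rightarrow> h y - h x | Some (k, e) \<Rightarrow> e * (R k y - R k x))" for y
  have "\<exists>c. (\<forall>i\<in>Some ` A. c i \<ge> 0) \<and> (\<forall>w\<in>range \<phi>. w None = (\<Sum>i\<in>Some ` A. c i * w i))"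
  proof (rule farkas)
    fix u v and r :: real assume "u \<in> range \<phi>" "v \<in> range \<phi>"
    then obtain y z where u: "u = \<phi> y" and v: "v = \<phi> z" by auto
    \<comment> \<open>The point \<open>(y - x) + r (z - x) + x\<close>: double the distance from \<open>x\<close> to the midpoint of \<open>y\<close> and
      \<open>x + r (z - x)\<close>.\<close>
    have "(\<lambda>i. u i + r * v i) = \<phi> (line 2 x (line (1/2) y (line r x z)))"
      by (rule ext) (auto simp: u v \<phi>_def h R algebra_simps split: option.splits)
    then show "(\<lambda>i. u i + r * v i) \<in> range \<phi>" by simp
  next
    fix w assume "w \<in> range \<phi>" and pos: "\<forall>i\<in>Some ` A. w i \<ge> 0"
    then obtain y where w: "w = \<phi> y" by auto
    have act: "e * R k y \<ge> 0" if "(k, e) \<in> A" for k e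
      using pos that by (force simp: w \<phi>_def A_def)
    have ev: "eventually (\<lambda>r. holds (C k) (line r x y)) (at_right 0)" if k: "k \<in> K" for k
    proof -
      have lim: "((\<lambda>r. residual (C k) (line r x y)) \<longlongrightarrow> residual (C k) x) (at_right 0)"
        unfolding C[OF k] by (auto intro!: tendsto_eq_intros)
      have pos: "eventually (\<lambda>r::real. r > 0) (at_right 0)"
        by (simp add: eventually_at_filter)
      show ?thesis
      proof (cases "residual (C k) x = 0")
        case True
        then have sgn: "e * residual (C k) y \<ge> 0" if "e \<in> {1, -1}" "multiplier_sign (C k) e" for e
          using act[of k e] k that by (auto simp: A_def R_def)
        have "holds (C k) (line r x y)" if "r > 0" for r
        proof -
          have res: "residual (C k) (line r x y) = r * residual (C k) y"
            using C[OF k, of r x y] True by simp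
          show ?thesis
          proof (cases "C k")
            case (Eq a b)
            then have "residual (C k) y = 0" using sgn[of 1] sgn[of "-1"] by simp
            with res show ?thesis by (simp add: Eq)
          next
            case (Le a b)
            then have "residual (C k) y \<le> 0" using sgn[of "-1"] by simp
            with res \<open>r > 0\<close> have "residual (C k) (line r x y) \<le> 0"
              by (simp add: mult_le_0_iff)
            then show ?thesis by (simp add: Le)
          next
            case (Ge a b)
            then have "residual (C k) y \<ge> 0" using sgn[of 1] by simp
            with res \<open>r > 0\<close> have "residual (C k) (line r x y) \<ge> 0" by simp
            then show ?thesis by (simp add: Ge)
          qed
        qed
        with pos show ?thesis by (auto elim: eventually_mono)
      next
        case False
        show ?thesis
        proof (cases "C k")
          case (Eq a b)
          then show ?thesis using feas[OF k] False by simp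
        next
          case (Le a b)
          then have "residual (C k) x < 0" using feas[OF k] False by simp
          from order_tendstoD(2)[OF lim this] show ?thesis
            by (rule eventually_mono) (simp add: Le)
        next
          case (Ge a b)
          then have "residual (C k) x > 0" using feas[OF k] False by simp
          from order_tendstoD(1)[OF lim this] show ?thesis
            by (rule eventually_mono) (simp add: Ge)
        qed
      qed
    qed
    have "eventually (\<lambda>r::real. (\<forall>k\<in>K. holds (C k) (line r x y)) \<and> r > 0) (at_right 0)"
      by (intro eventually_conj eventually_ball_finite \<open>finite K\<close> ballI ev)
        (simp_all add: eventually_at_filter)
    from eventually_happens'[OF _ this] obtain r :: real
      where r: "r > 0" "\<And>k. k \<in> K \<Longrightarrow> holds (C k) (line r x y)" by auto
    have "0 \<le> r * (h y - h x)"
      using least[OF r(2)] by (simp add: h algebra_simps)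
    then show "w None \<ge> 0" using r(1) by (simp add: w \<phi>_def zero_le_mult_iff)
  qed simp
  then obtain c0 where c0: "\<forall>i\<in>Some ` A. c0 i \<ge> 0"
    "\<forall>w\<in>range \<phi>. w None = (\<Sum>i\<in>Some ` A. c0 i * w i)" by blast
  define c where "c a = (if a \<in> A then c0 (Some a) else 0)" for a
  have c: "c a \<ge> 0" for a using c0(1) by (simp add: c_def)
  have rep: "h y - h x = (\<Sum>(k, e)\<in>K \<times> {1, -1}. c (k, e) * e * R k y)" for y
  proof -
    have "h y - h x = \<phi> y None" by (simp add: \<phi>_def)
    also have "\<dots> = (\<Sum>i\<in>Some ` A. c0 i * \<phi> y i)" using c0(2) by blast
    also have "\<dots> = (\<Sum>a\<in>A. c0 (Some a) * \<phi> y (Some a))" by (simp add: sum.reindex)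
    also have "\<dots> = (\<Sum>(k, e)\<in>A. c (k, e) * e * R k y)"
      by (rule sum.cong) (auto simp: c_def \<phi>_def A_def)
    also have "\<dots> = (\<Sum>(k, e)\<in>K \<times> {1, -1}. c (k, e) * e * R k y)"
      by (rule sum.mono_neutral_left) (use \<open>finite K\<close> in \<open>auto simp: A_def c_def split: if_splits\<close>)
    finally show ?thesis .
  qed
  define q where "q k = c (k, 1) - c (k, -1)" for k
  have "multiplier_sign (C k) (q k)" if "k \<in> K" for k
    using c[of "(k, 1)"] c[of "(k, -1)"]
    by (cases "C k") (auto simp: q_def c_def[of "(k, 1)"] c_def[of "(k, -1)"] A_def)
  moreover have "lagrangian h K C y q = h x" for y
  proof -
    have "h y - h x = (\<Sum>k\<in>K. \<Sum>e\<in>{1, -1}. c (k, e) * e * R k y)"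
      unfolding rep by (rule sum.cartesian_product[symmetric])
    also have "\<dots> = (\<Sum>k\<in>K. q k * residual (C k) y)"
      by (rule sum.cong) (auto simp: q_def R_def algebra_simps)
    finally show ?thesis by (simp add: lagrangian_def)
  qed
  ultimately show ?thesis using that by blast
qed

text \<open>A dual solution is at least as good as the certificate above, whose dual value is the primal
  optimum.\<close>

lemma lagrangian_ge_primal_optimum:
  fixes line :: "real \<Rightarrow> 'x \<Rightarrow> 'x \<Rightarrow> 'x"
  assumes "finite K" and opt: "primal_optimal h K C x" and dual: "lagrangian_dual_optimal h K C p"
    and "\<And>r y z. h (line r y z) = (1 - r) * h y + r * h z"
    and "\<And>r y z k. k \<in> K \<Longrightarrow>
      residual (C k) (line r y z) = (1 - r) * residual (C k) y + r * residual (C k) z"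
  shows "h x \<le> lagrangian h K C y p"
proof -
  obtain q where q: "\<forall>k\<in>K. multiplier_sign (C k) (q k)" "\<And>y. lagrangian h K C y q = h x"
    using primal_optimal_has_certificate[OF assms(1,2,4,5)] by blast
  have "ereal (h x) = dual_function h K C q"
    by (simp add: dual_function_def q(2))
  also have "\<dots> \<le> dual_function h K C p"
    using dual q(1) by (auto simp: lagrangian_dual_optimal_def is_arg_max_def not_less)
  also have "\<dots> \<le> ereal (lagrangian h K C y p)"
    unfolding dual_function_def by (rule INF_lower) simp
  finally show ?thesis by simp
qed

text \<open>The sensitivity meaning of the multipliers: a point that violates only the constraints in \<open>B\<close>
  can improve on the optimum by at most the violation valued at \<open>p\<close>.\<close>

lemma shadow_price_bound:
  fixes line :: "real \<Rightarrow> 'x \<Rightarrow> 'x \<Rightarrow> 'x"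
  assumes "finite K" and "primal_optimal h K C x" and dual: "lagrangian_dual_optimal h K C p"
    and "\<And>r y z. h (line r y z) = (1 - r) * h y + r * h z"
    and "\<And>r y z k. k \<in> K \<Longrightarrow>
      residual (C k) (line r y z) = (1 - r) * residual (C k) y + r * residual (C k) z"
    and "B \<subseteq> K" and y: "\<And>k. k \<in> K - B \<Longrightarrow> holds (C k) y"
  shows "h x \<le> h y - (\<Sum>k\<in>B. p k * residual (C k) y)"
proof -
  have "(\<Sum>k\<in>K - B. p k * residual (C k) y) \<ge> 0"
    using dual y by (intro sum_nonneg multiplier_times_residual_nonneg)
      (auto simp: lagrangian_dual_optimal_def is_arg_max_def)
  moreover have "(\<Sum>k\<in>K. p k * residual (C k) y) =
      (\<Sum>k\<in>K - B. p k * residual (C k) y) + (\<Sum>k\<in>B. p k * residual (C k) y)"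
    using assms(1,6) by (rule sum.subset_diff[rotated])
  moreover have "h x \<le> lagrangian h K C y p"
    using assms(1-5) by (rule lagrangian_ge_primal_optimum)
  ultimately show ?thesis by (simp add: lagrangian_def)
qed

section \<open>The combined storage model is a linear program\<close>

definition csm_line ::
  "real \<Rightarrow> ('n, 'g, 's) csm_point \<Rightarrow> ('n, 'g, 's) csm_point \<Rightarrow> ('n, 'g, 's) csm_point" where
  "csm_line r y z =
     (let mix = (\<lambda>a b t. (1 - r) * a t + r * b t) in
      \<lparr>gen_out = \<lambda>g. mix (gen_out y g) (gen_out z g),
       angle = \<lambda>i. mix (angle y i) (angle z i),
       flow = \<lambda>l. mix (flow y l) (flow z l),
       charge = \<lambda>s. mix (charge y s) (charge z s),
       discharge = \<lambda>s. mix (discharge y s) (discharge z s),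
       level = \<lambda>s. mix (level y s) (level z s),
       price = \<lambda>i. mix (price y i) (price z i),
       gamma_up = \<lambda>g. mix (gamma_up y g) (gamma_up z g),
       gamma_lo = \<lambda>g. mix (gamma_lo y g) (gamma_lo z g),
       rho_up = \<lambda>l. mix (rho_up y l) (rho_up z l),
       rho_lo = \<lambda>l. mix (rho_lo y l) (rho_lo z l),
       zeta = \<lambda>l. mix (zeta y l) (zeta z l),
       alpha = \<lambda>s. mix (alpha y s) (alpha z s),
       beta_up = \<lambda>s. mix (beta_up y s) (beta_up z s),
       beta_lo = \<lambda>s. mix (beta_lo y s) (beta_lo z s),
       tau_ch = \<lambda>s. mix (tau_ch y s) (tau_ch z s),
       tau_dis = \<lambda>s. mix (tau_dis y s) (tau_dis z s)\<rparr>)"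

lemma csm_line_select [simp]:
  "gen_out (csm_line r y z) g t = (1 - r) * gen_out y g t + r * gen_out z g t"
  "angle (csm_line r y z) i t = (1 - r) * angle y i t + r * angle z i t"
  "flow (csm_line r y z) l t = (1 - r) * flow y l t + r * flow z l t"
  "charge (csm_line r y z) s t = (1 - r) * charge y s t + r * charge z s t"
  "discharge (csm_line r y z) s t = (1 - r) * discharge y s t + r * discharge z s t"
  "level (csm_line r y z) s t = (1 - r) * level y s t + r * level z s t"
  "price (csm_line r y z) i t = (1 - r) * price y i t + r * price z i t"
  "gamma_up (csm_line r y z) g t = (1 - r) * gamma_up y g t + r * gamma_up z g t"
  "gamma_lo (csm_line r y z) g t = (1 - r) * gamma_lo y g t + r * gamma_lo z g t"
  "rho_up (csm_line r y z) l t = (1 - r) * rho_up y l t + r * rho_up z l t"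
  "rho_lo (csm_line r y z) l t = (1 - r) * rho_lo y l t + r * rho_lo z l t"
  "zeta (csm_line r y z) l t = (1 - r) * zeta y l t + r * zeta z l t"
  "alpha (csm_line r y z) s t = (1 - r) * alpha y s t + r * alpha z s t"
  "beta_up (csm_line r y z) s t = (1 - r) * beta_up y s t + r * beta_up z s t"
  "beta_lo (csm_line r y z) s t = (1 - r) * beta_lo y s t + r * beta_lo z s t"
  "tau_ch (csm_line r y z) s t = (1 - r) * tau_ch y s t + r * tau_ch z s t"
  "tau_dis (csm_line r y z) s t = (1 - r) * tau_dis y s t + r * tau_dis z s t"
  by (simp_all add: csm_line_def Let_def)

lemma csm_objective_line:
  "csm_objective D (csm_line r y z) = (1 - r) * csm_objective D y + r * csm_objective D z"
  by (simp add: csm_objective_def sum_distrib_left sum.distrib[symmetric]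
      algebra_simps)

lemma alpha_ext_line:
  "alpha_ext D (csm_line r y z) s t = (1 - r) * alpha_ext D y s t + r * alpha_ext D z s t"
  by (simp add: alpha_ext_def)

lemma csm_residual_line:
  "residual (csm_constr D k) (csm_line r y z) =
     (1 - r) * residual (csm_constr D k) y + r * residual (csm_constr D k) z"
  by (cases k)
    (simp_all add: alpha_ext_line algebra_simps sum.distrib sum_subtractf sum_distrib_left sum_negf add_divide_distrib
      diff_divide_distrib del: sum.cl_ivl_Suc)

lemma finite_csm_indices: "wf_network D \<Longrightarrow> finite (csm_indices D)"
  by (auto simp: csm_indices_def wf_network_def)

section \<open>Schedules are cost-optimal at the nodal prices\<close>

lemma price_at_stor_node:
  assumes "wf_network D" "s \<in> stors D"
  shows "(\<Sum>i\<in>{i \<in> nodes D. s \<in> stors_at D i}. q i) = q (stor_node D s)"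
proof -
  have "{i \<in> nodes D. s \<in> stors_at D i} = {stor_node D s}"
    using assms by (auto simp: wf_network_def stors_at_def)
  then show ?thesis by simp
qed

lemma price_at_gen_node:
  assumes "wf_network D" "g \<in> gens D"
  shows "(\<Sum>i\<in>{i \<in> nodes D. g \<in> gens_at D i}. q i) = q (gen_node D g)"
proof -
  have "{i \<in> nodes D. g \<in> gens_at D i} = {gen_node D g}"
    using assms by (auto simp: wf_network_def gens_at_def)
  then show ?thesis by simp
qed

lemma sum_over_locations:
  fixes q :: "'n \<Rightarrow> real"
  assumes "finite S" "finite N" "loc ` S \<subseteq> N"
  shows "(\<Sum>i\<in>N. q i * (\<Sum>a\<in>{a \<in> S. loc a = i}. v a)) = (\<Sum>a\<in>S. q (loc a) * v a)"
proof -
  have "(\<Sum>i\<in>N. q i * (\<Sum>a\<in>{a \<in> S. loc a = i}. v a)) =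
        (\<Sum>i\<in>N. \<Sum>a\<in>{a \<in> S. loc a = i}. q (loc a) * v a)"
    unfolding sum_distrib_left by (intro sum.cong) auto
  also have "\<dots> = (\<Sum>a\<in>S. q (loc a) * v a)"
    using assms by (rule sum.group)
  finally show ?thesis .
qed

text \<open>Moves the difference from the storage levels to the multipliers \<open>\<alpha>\<close>, where the dual constraint
  of the level variable applies.\<close>

lemma summation_by_parts:
  fixes a E :: "nat \<Rightarrow> real"
  shows "(\<Sum>t=1..m. a t * (E (t + 1) - E t)) =
    (\<Sum>t=1..m. (a t - a (t + 1)) * E (t + 1)) + a (m + 1) * E (m + 1) - a 1 * E 1"
  by (induction m) (auto simp: algebra_simps)

text \<open>The dual objective of the cost minimization of \<open>s\<close>: among its constraints only the level
  bounds have a nonzero right-hand side.\<close>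

definition level_rent :: "('n, 'g, 's) network \<Rightarrow> ('n, 'g, 's) csm_point \<Rightarrow> 's \<Rightarrow> real" where
  "level_rent D x s = (\<Sum>t\<in>level_periods D. beta_up x s t * level_max D s)"

text \<open>Price equals \<open>\<eta> \<alpha> + \<tau>\<^sup>+\<close> for charging and \<open>\<alpha> / \<eta> - \<tau>\<^sup>-\<close> for discharging, so the cost of a
  schedule is \<open>\<alpha>\<close> times the increase of the level, up to nonnegative terms. Summation by parts
  turns this into the level times \<open>\<beta>\<^sup>+ + \<beta>\<^sup>-\<close>, and the level bounds finish the estimate.\<close>

lemma schedule_weak_duality:
  assumes wf: "wf_network D" and x: "feasible (csm_indices D) (csm_constr D) x"
    and s: "s \<in> stors D" and y: "schedule_feasible D s y E"
  shows "level_rent D x s \<le> schedule_value D s (price x) y"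
proof -
  let ?\<alpha> = "alpha_ext D x s"
  have H: "holds (csm_constr D k) x" if "k \<in> csm_indices D" for k
    using x that by (auto simp: feasible_def)
  have dual: "price x (stor_node D s) t = eta D * alpha x s t + tau_ch x s t"
      "price x (stor_node D s) t = 1 / eta D * alpha x s t - tau_dis x s t"
      "tau_ch x s t \<ge> 0" "tau_dis x s t \<ge> 0"
    if t: "t \<in> periods D" for t
  proof -
    have "{Dual_charge s t, Dual_discharge s t, Sign_tau_ch s t, Sign_tau_dis s t} \<subseteq> csm_indices D"
      using s t by (auto simp: csm_indices_def)
    then show "price x (stor_node D s) t = eta D * alpha x s t + tau_ch x s t"
        "price x (stor_node D s) t = 1 / eta D * alpha x s t - tau_dis x s t"
        "tau_ch x s t \<ge> 0" "tau_dis x s t \<ge> 0"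
      using H[of "Dual_charge s t"] H[of "Dual_discharge s t"] H[of "Sign_tau_ch s t"]
        H[of "Sign_tau_dis s t"] price_at_stor_node[OF wf s, of "\<lambda>i. price x i t"] by auto
  qed
  have rent: "beta_up x s (t + 1) * level_max D s \<le> (?\<alpha> t - ?\<alpha> (t + 1)) * E (t + 1)"
    if t: "t \<in> periods D" for t
  proof -
    have "{Dual_level s (t + 1), Sign_beta_up s (t + 1), Sign_beta_lo s (t + 1)} \<subseteq> csm_indices D"
      using s t by (auto simp: csm_indices_def)
    then have b: "?\<alpha> t - ?\<alpha> (t + 1) = beta_up x s (t + 1) + beta_lo x s (t + 1)"
        "beta_up x s (t + 1) \<le> 0" "beta_lo x s (t + 1) \<ge> 0"
      using H[of "Dual_level s (t + 1)"] H[of "Sign_beta_up s (t + 1)"]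
        H[of "Sign_beta_lo s (t + 1)"] by auto
    have E: "0 \<le> E (t + 1)" "E (t + 1) \<le> level_max D s"
      using y t by (auto simp: schedule_feasible_def)
    have "beta_up x s (t + 1) * level_max D s \<le> beta_up x s (t + 1) * E (t + 1)"
      using b(2) E(2) by (rule mult_left_mono_neg[rotated])
    moreover have "0 \<le> beta_lo x s (t + 1) * E (t + 1)"
      using b(3) E(1) by simp
    ultimately show ?thesis unfolding b(1) by (simp add: algebra_simps)
  qed
  have "level_rent D x s = (\<Sum>t\<in>periods D. beta_up x s (t + 1) * level_max D s)"
    using sum.shift_bounds_cl_Suc_ivl[of "\<lambda>t. beta_up x s t * level_max D s" 1 "horizon D"]
    by (simp add: level_rent_def numeral_2_eq_2)
  also have "\<dots> \<le> (\<Sum>t\<in>periods D. (?\<alpha> t - ?\<alpha> (t + 1)) * E (t + 1))"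
    using rent by (rule sum_mono)
  also have "\<dots> = (\<Sum>t\<in>periods D. ?\<alpha> t * (E (t + 1) - E t))"
  proof -
    have "?\<alpha> (horizon D + 1) = 0" by (simp add: alpha_ext_def)
    moreover have "E 1 = 0" using y by (simp add: schedule_feasible_def)
    ultimately show ?thesis using summation_by_parts[of ?\<alpha> E "horizon D"] by simp
  qed
  also have "\<dots> \<le> (\<Sum>t\<in>periods D. price x (stor_node D s) t * (fst y t - snd y t))"
  proof (rule sum_mono)
    fix t assume t: "t \<in> periods D"
    have "price x (stor_node D s) t * (fst y t - snd y t) =
        (eta D * alpha x s t + tau_ch x s t) * fst y t
        - (1 / eta D * alpha x s t - tau_dis x s t) * snd y t"
      using dual(1,2)[OF t] by (simp add: right_diff_distrib)
    also have "\<dots> = alpha x s t * (eta D * fst y t - 1 / eta D * snd y t)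
        + tau_ch x s t * fst y t + tau_dis x s t * snd y t"
      by (simp add: algebra_simps)
    also have "eta D * fst y t - 1 / eta D * snd y t = E (t + 1) - E t"
    proof -
      have "E t + eta D * fst y t - 1 / eta D * snd y t - E (t + 1) = 0"
        using y t unfolding schedule_feasible_def by blast
      then show ?thesis by linarith
    qed
    finally show "?\<alpha> t * (E (t + 1) - E t) \<le> price x (stor_node D s) t * (fst y t - snd y t)"
      using dual(3,4)[OF t] y t by (simp add: schedule_feasible_def alpha_ext_def)
  qed
  finally show ?thesis by (simp add: schedule_value_def)
qed

lemma csm_schedule_feasible:
  assumes x: "feasible (csm_indices D) (csm_constr D) x" and s: "s \<in> stors D"
  shows "schedule_feasible D s (charge x s, discharge x s) (level x s)"
proof -
  have H: "holds (csm_constr D k) x" if "k \<in> csm_indices D" for k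
    using x that by (auto simp: feasible_def)
  have init: "level x s 1 = 0"
    using H[of "Level_init s"] s by (auto simp: csm_indices_def)
  have lev: "0 \<le> level x s t \<and> level x s t \<le> level_max D s" if "t \<in> level_periods D" for t
    using H[of "Level_lo s t"] H[of "Level_up s t"] s that by (auto simp: csm_indices_def)
  have "0 \<le> level x s t" if "t \<in> {1..horizon D + 1}" for t
    using init lev[of t] that by (cases "t = 1") auto
  moreover have "0 \<le> charge x s t \<and> 0 \<le> discharge x s t \<and>
      level x s t + eta D * charge x s t - 1 / eta D * discharge x s t - level x s (t + 1) = 0"
    if "t \<in> periods D" for t
    using H[of "Charge_nonneg s t"] H[of "Discharge_nonneg s t"] H[of "Storage_dyn s t"] s that
    by (auto simp: csm_indices_def)
  ultimately show ?thesis
    using init lev by (simp add: schedule_feasible_def)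
qed

text \<open>The right-hand side is the contribution of period \<open>t\<close> to the strong duality constraint. Valuing
  the balance constraints at \<open>\<pi>\<close> replaces demand by generation, flows and storage; the storage
  part is the left-hand side. Weak duality for generators bounds the generation part by
  cost minus the \<open>\<gamma>\<close> terms, and weak duality for the network bounds the flow part by the \<open>\<rho>\<close> terms.\<close>

lemma storage_payments_le_net_cost:
  assumes wf: "wf_network D" and x: "feasible (csm_indices D) (csm_constr D) x"
    and t: "t \<in> periods D"
  shows "(\<Sum>s\<in>stors D. price x (stor_node D s) t * (charge x s t - discharge x s t)) \<le>
      (\<Sum>g\<in>gens D. gen_cost D g * gen_out x g t)
    - (\<Sum>i\<in>nodes D. demand D i t * price x i t)
    - (\<Sum>l\<in>lines D. (rho_up x l t - rho_lo x l t) * flow_max D l)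
    - (\<Sum>g\<in>gens D. gamma_up x g t * gen_max D g + gamma_lo x g t * gen_min D g)"
proof -
  let ?\<pi> = "\<lambda>i. price x i t"
  let ?f = "\<lambda>l. flow x l t"
  have H: "holds (csm_constr D k) x" if "k \<in> csm_indices D" for k
    using x that by (auto simp: feasible_def)
  note fin = wf[unfolded wf_network_def]
  have "(\<Sum>i\<in>nodes D. demand D i t * ?\<pi> i) =
     (\<Sum>i\<in>nodes D. ?\<pi> i * (\<Sum>g\<in>gens_at D i. gen_out x g t))
     - (\<Sum>i\<in>nodes D. ?\<pi> i * (\<Sum>l\<in>lines_from D i. ?f l))
     + (\<Sum>i\<in>nodes D. ?\<pi> i * (\<Sum>l\<in>lines_to D i. ?f l))
     - (\<Sum>i\<in>nodes D. ?\<pi> i * (\<Sum>s\<in>stors_at D i. charge x s t - discharge x s t))"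
    unfolding sum_subtractf[symmetric] sum.distrib[symmetric]
  proof (rule sum.cong)
    fix i assume "i \<in> nodes D"
    then have "Balance i t \<in> csm_indices D" using t by (auto simp: csm_indices_def)
    from H[OF this] have eq: "demand D i t =
        (\<Sum>g\<in>gens_at D i. gen_out x g t) - (\<Sum>l\<in>lines_from D i. ?f l)
        + (\<Sum>l\<in>lines_to D i. ?f l) - (\<Sum>s\<in>stors_at D i. charge x s t - discharge x s t)"
      by simp
    show "demand D i t * ?\<pi> i = ?\<pi> i * (\<Sum>g\<in>gens_at D i. gen_out x g t)
        - ?\<pi> i * (\<Sum>l\<in>lines_from D i. ?f l) + ?\<pi> i * (\<Sum>l\<in>lines_to D i. ?f l)
        - ?\<pi> i * (\<Sum>s\<in>stors_at D i. charge x s t - discharge x s t)"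
      unfolding eq by (simp only: ring_distribs mult.commute[of _ "?\<pi> i"])
  qed simp
  also have "(\<Sum>i\<in>nodes D. ?\<pi> i * (\<Sum>g\<in>gens_at D i. gen_out x g t)) =
      (\<Sum>g\<in>gens D. ?\<pi> (gen_node D g) * gen_out x g t)"
    unfolding gens_at_def by (rule sum_over_locations) (use fin in auto)
  also have "(\<Sum>i\<in>nodes D. ?\<pi> i * (\<Sum>s\<in>stors_at D i. charge x s t - discharge x s t)) =
      (\<Sum>s\<in>stors D. ?\<pi> (stor_node D s) * (charge x s t - discharge x s t))"
    unfolding stors_at_def by (rule sum_over_locations) (use fin in auto)
  also have "(\<Sum>i\<in>nodes D. ?\<pi> i * (\<Sum>l\<in>lines_from D i. ?f l)) =
      (\<Sum>l\<in>lines D. ?\<pi> (fst l) * ?f l)"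
    unfolding lines_from_def by (rule sum_over_locations) (use fin in auto)
  also have "(\<Sum>i\<in>nodes D. ?\<pi> i * (\<Sum>l\<in>lines_to D i. ?f l)) =
      (\<Sum>l\<in>lines D. ?\<pi> (snd l) * ?f l)"
    unfolding lines_to_def by (rule sum_over_locations) (use fin in auto)
  finally have demand: "(\<Sum>i\<in>nodes D. demand D i t * ?\<pi> i) =
      (\<Sum>g\<in>gens D. ?\<pi> (gen_node D g) * gen_out x g t)
      - (\<Sum>l\<in>lines D. (?\<pi> (fst l) - ?\<pi> (snd l)) * ?f l)
      - (\<Sum>s\<in>stors D. ?\<pi> (stor_node D s) * (charge x s t - discharge x s t))"
    by (simp add: left_diff_distrib sum_subtractf)
  have gens: "(\<Sum>g\<in>gens D. ?\<pi> (gen_node D g) * gen_out x g t) \<le>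
      (\<Sum>g\<in>gens D. gen_cost D g * gen_out x g t
        - (gamma_up x g t * gen_max D g + gamma_lo x g t * gen_min D g))"
  proof (rule sum_mono)
    fix g assume g: "g \<in> gens D"
    have "{Dual_gen g t, Sign_gamma_up g t, Sign_gamma_lo g t, Gen_up g t, Gen_lo g t}
        \<subseteq> csm_indices D"
      using g t by (auto simp: csm_indices_def)
    then have c: "gamma_up x g t + gamma_lo x g t + ?\<pi> (gen_node D g) = gen_cost D g"
        "gamma_up x g t \<le> 0" "gamma_lo x g t \<ge> 0"
        "gen_out x g t \<le> gen_max D g" "gen_out x g t \<ge> gen_min D g"
      using H[of "Dual_gen g t"] H[of "Sign_gamma_up g t"] H[of "Sign_gamma_lo g t"]
        H[of "Gen_up g t"] H[of "Gen_lo g t"] price_at_gen_node[OF wf g, of ?\<pi>] by auto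
    have "0 \<le> gamma_up x g t * (gen_out x g t - gen_max D g)"
        "0 \<le> gamma_lo x g t * (gen_out x g t - gen_min D g)"
      using c(2-5) by (auto intro: mult_nonpos_nonpos)
    then show "?\<pi> (gen_node D g) * gen_out x g t \<le> gen_cost D g * gen_out x g t
        - (gamma_up x g t * gen_max D g + gamma_lo x g t * gen_min D g)"
      unfolding c(1)[symmetric] by (simp add: algebra_simps)
  qed
  \<comment> \<open>Substituting the angle differences for the flows leaves the dual angle constraint of each
    node, weighted by the angle.\<close>
  have "(\<Sum>l\<in>lines D. zeta x l t * ?f l) =
      (\<Sum>l\<in>lines D. angle x (fst l) t * (admittance D l * zeta x l t))
      - (\<Sum>l\<in>lines D. angle x (snd l) t * (admittance D l * zeta x l t))"
    unfolding sum_subtractf[symmetric]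
  proof (rule sum.cong)
    fix l assume "l \<in> lines D"
    then have "Line_flow l t \<in> csm_indices D" using t by (auto simp: csm_indices_def)
    from H[OF this] have eq: "?f l = admittance D l * (angle x (fst l) t - angle x (snd l) t)"
      by simp
    show "zeta x l t * ?f l = angle x (fst l) t * (admittance D l * zeta x l t)
        - angle x (snd l) t * (admittance D l * zeta x l t)"
      unfolding eq by (simp add: algebra_simps)
  qed simp
  also have "(\<Sum>l\<in>lines D. angle x (fst l) t * (admittance D l * zeta x l t)) =
      (\<Sum>i\<in>nodes D. angle x i t * (\<Sum>l\<in>lines_from D i. admittance D l * zeta x l t))"
    unfolding lines_from_def by (rule sum_over_locations[symmetric]) (use fin in auto)
  also have "(\<Sum>l\<in>lines D. angle x (snd l) t * (admittance D l * zeta x l t)) =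
      (\<Sum>i\<in>nodes D. angle x i t * (\<Sum>l\<in>lines_to D i. admittance D l * zeta x l t))"
    unfolding lines_to_def by (rule sum_over_locations[symmetric]) (use fin in auto)
  also have "(\<Sum>i\<in>nodes D. angle x i t * (\<Sum>l\<in>lines_from D i. admittance D l * zeta x l t)) =
      (\<Sum>i\<in>nodes D. angle x i t * (\<Sum>l\<in>lines_to D i. admittance D l * zeta x l t))"
  proof (rule sum.cong)
    fix i assume "i \<in> nodes D"
    then have "Dual_angle i t \<in> csm_indices D" using t by (auto simp: csm_indices_def)
    from H[OF this] show "angle x i t * (\<Sum>l\<in>lines_from D i. admittance D l * zeta x l t) =
        angle x i t * (\<Sum>l\<in>lines_to D i. admittance D l * zeta x l t)" by simp
  qed simp
  finally have zeta: "(\<Sum>l\<in>lines D. zeta x l t * ?f l) = 0" by simp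
  have "(\<Sum>l\<in>lines D. (rho_up x l t - rho_lo x l t) * flow_max D l - zeta x l t * ?f l) \<le>
      (\<Sum>l\<in>lines D. (?\<pi> (fst l) - ?\<pi> (snd l)) * ?f l)"
  proof (rule sum_mono)
    fix l assume l: "l \<in> lines D"
    have "{Dual_flow l t, Sign_rho_up l t, Sign_rho_lo l t, Flow_up l t, Flow_lo l t}
        \<subseteq> csm_indices D"
      using l t by (auto simp: csm_indices_def)
    then have c: "?\<pi> (fst l) - ?\<pi> (snd l) = rho_up x l t + rho_lo x l t - zeta x l t"
        "rho_up x l t \<le> 0" "rho_lo x l t \<ge> 0"
        "?f l \<le> flow_max D l" "?f l \<ge> - flow_max D l"
      using H[of "Dual_flow l t"] H[of "Sign_rho_up l t"] H[of "Sign_rho_lo l t"]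
        H[of "Flow_up l t"] H[of "Flow_lo l t"] by auto
    have "0 \<le> rho_up x l t * (?f l - flow_max D l)" "0 \<le> rho_lo x l t * (?f l + flow_max D l)"
      using c(2-5) by (auto intro: mult_nonpos_nonpos)
    then show "(rho_up x l t - rho_lo x l t) * flow_max D l - zeta x l t * ?f l \<le>
        (?\<pi> (fst l) - ?\<pi> (snd l)) * ?f l"
      unfolding c(1) by (simp add: algebra_simps)
  qed
  with demand gens zeta show ?thesis by (simp add: sum_subtractf)
qed

text \<open>Strong duality holds only for the sum over all storage resources. Weak duality bounds each
  summand from the other side, so no resource can have a gap.\<close>

lemma csm_schedule_cost_le_level_rent:
  assumes wf: "wf_network D" and x: "feasible (csm_indices D) (csm_constr D) x"
    and s: "s \<in> stors D"
  shows "schedule_value D s (price x) (charge x s, discharge x s) \<le> level_rent D x s"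
proof -
  let ?v = "\<lambda>s. schedule_value D s (price x) (charge x s, discharge x s)"
  have "(\<Sum>s\<in>stors D. ?v s) =
      (\<Sum>t\<in>periods D. \<Sum>s\<in>stors D. price x (stor_node D s) t * (charge x s t - discharge x s t))"
    unfolding schedule_value_def by (subst sum.swap) simp
  also have "\<dots> \<le> (\<Sum>t\<in>periods D.
      (\<Sum>g\<in>gens D. gen_cost D g * gen_out x g t)
    - (\<Sum>i\<in>nodes D. demand D i t * price x i t)
    - (\<Sum>l\<in>lines D. (rho_up x l t - rho_lo x l t) * flow_max D l)
    - (\<Sum>g\<in>gens D. gamma_up x g t * gen_max D g + gamma_lo x g t * gen_min D g))"
    by (rule sum_mono) (rule storage_payments_le_net_cost[OF wf x])
  also have "\<dots> \<le> (\<Sum>s\<in>stors D. level_rent D x s)"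
  proof -
    have "Strong_duality \<in> csm_indices D" by (simp add: csm_indices_def)
    with x have "holds (csm_constr D Strong_duality) x" unfolding feasible_def by blast
    then show ?thesis by (simp add: level_rent_def)
  qed
  finally have total: "(\<Sum>s\<in>stors D. ?v s) \<le> (\<Sum>s\<in>stors D. level_rent D x s)" .
  have each: "level_rent D x r \<le> ?v r" if "r \<in> stors D" for r
    using schedule_weak_duality[OF wf x that csm_schedule_feasible[OF x that]] .
  show ?thesis
  proof (rule ccontr)
    assume "\<not> ?thesis"
    then have "(\<Sum>s\<in>stors D. level_rent D x s) < (\<Sum>s\<in>stors D. ?v s)"
      using wf s each by (intro sum_strict_mono_ex1) (auto simp: wf_network_def not_le)
    with total show False by simp
  qed
qed

section \<open>Schedules are optimal at marginal emissions\<close>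

text \<open>The point \<open>x'\<close> with the schedule of \<open>s\<close> exchanged violates only balances at the node of \<open>s\<close>, by
  the change in net charge, and it has the same objective value as \<open>x\<close>. The shadow price bound
  therefore leaves only the change in net charge valued at \<open>p\<close>.\<close>

lemma balance_multiplier_optimal:
  fixes D :: "('n, 'g, 's) network"
  assumes wf: "wf_network D" and x: "csm_optimal D x" and p: "csm_dual_optimal D p"
    and s: "s \<in> stors D" and y: "schedule_feasible D s y E"
  shows "schedule_value D s (\<lambda>i t. p (Balance i t)) (charge x s, discharge x s) \<le>
    schedule_value D s (\<lambda>i t. p (Balance i t)) y"
proof -
  let ?n = "stor_node D s"
  have feas: "feasible (csm_indices D) (csm_constr D) x"
    using x by (simp add: csm_optimal_def primal_optimal_def is_arg_min_def)
  have n: "?n \<in> nodes D" using wf s by (auto simp: wf_network_def)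
  have fin: "finite (stors_at D i)" for i using wf by (simp add: wf_network_def stors_at_def)
  define x' where "x' = x\<lparr>charge := (charge x)(s := fst y), discharge := (discharge x)(s := snd y),
    level := (level x)(s := E)\<rparr>"
  have other: "(\<Sum>r\<in>stors_at D i. charge x' r t - discharge x' r t) =
      (\<Sum>r\<in>stors_at D i. charge x r t - discharge x r t)" if "i \<noteq> ?n" for i t
    by (rule sum.cong) (use that in \<open>auto simp: x'_def stors_at_def\<close>)
  have "s \<in> stors_at D ?n" using s by (simp add: stors_at_def)
  then have at_n: "(\<Sum>r\<in>stors_at D ?n. charge x' r t - discharge x' r t) =
      (\<Sum>r\<in>stors_at D ?n. charge x r t - discharge x r t)
      + (fst y t - snd y t) - (charge x s t - discharge x s t)" for t
    by (subst (1 2) sum.remove[OF fin]) (auto simp: x'_def intro!: sum.cong)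
  define B :: "('n, 'g, 's) csm_index set" where "B = Balance ?n ` periods D"
  have BK: "B \<subseteq> csm_indices D"
    using n by (auto simp: B_def csm_indices_def)
  have "holds (csm_constr D k) x'" if k: "k \<in> csm_indices D - B" for k
  proof -
    have old: "holds (csm_constr D k) x" using feas k by (simp add: feasible_def)
    show ?thesis
    proof (cases k)
      case (Balance i t)
      then have "i \<noteq> ?n" using k by (auto simp: B_def csm_indices_def)
      from other[OF this] old show ?thesis by (simp add: Balance) (simp add: x'_def)
    qed (use old k y s in \<open>auto simp: x'_def csm_indices_def schedule_feasible_def alpha_ext_def
          simp del: sum.cl_ivl_Suc\<close>)
  qed
  then have "csm_objective D x \<le> csm_objective D x'
      - (\<Sum>k\<in>B. p k * residual (csm_constr D k) x')"
    by (intro shadow_price_bound[where line = csm_line, OF finite_csm_indices[OF wf]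
          x[unfolded csm_optimal_def] p[unfolded csm_dual_optimal_def]
          csm_objective_line csm_residual_line BK]) auto
  moreover have "csm_objective D x' = csm_objective D x"
    by (simp add: csm_objective_def x'_def)
  moreover have "(\<Sum>k\<in>B. p k * residual (csm_constr D k) x') =
      (\<Sum>t\<in>periods D. p (Balance ?n t) *
        ((charge x s t - discharge x s t) - (fst y t - snd y t)))"
  proof -
    have "residual (csm_constr D (Balance ?n t)) x' =
        (charge x s t - discharge x s t) - (fst y t - snd y t)" if "t \<in> periods D" for t
    proof -
      have "Balance ?n t \<in> csm_indices D" using BK that by (auto simp: B_def)
      then have "holds (csm_constr D (Balance ?n t)) x"
        using feas unfolding feasible_def by blast
      then show ?thesis using at_n[of t] by simp (simp add: x'_def)
    qed
    moreover have "inj_on (Balance ?n :: nat \<Rightarrow> ('n, 'g, 's) csm_index) (periods D)" by (simp add: inj_on_def)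
    ultimately show ?thesis by (simp add: B_def sum.reindex del: csm_constr.simps)
  qed
  ultimately show ?thesis
    by (simp add: schedule_value_def right_diff_distrib sum_subtractf)
qed

theorem theorem8:
  fixes D :: "('n, 'g, 's) network"
    and x :: "('n, 'g, 's) csm_point"
    and p :: "('n, 'g, 's) csm_index \<Rightarrow> real"
    and LMP LME :: "'n \<Rightarrow> nat \<Rightarrow> real"
  assumes "wf_network D"
    and "csm_optimal D x"
    and "csm_dual_optimal D p"
    and "\<And>i t. i \<in> nodes D \<Longrightarrow> t \<in> periods D \<Longrightarrow> LMP i t = price x i t"
    and "\<And>i t. i \<in> nodes D \<Longrightarrow> t \<in> periods D \<Longrightarrow>
           LME i t = p (Balance i t) + p Strong_duality * price x i t"
  shows "\<forall>s\<in>stors D. decentralized_optimal D LMP LME s (charge x s, discharge x s)"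
proof
  fix s assume s: "s \<in> stors D"
  let ?y = "(charge x s, discharge x s)"
  have x: "feasible (csm_indices D) (csm_constr D) x"
    using assms(2) by (simp add: csm_optimal_def primal_optimal_def is_arg_min_def)
  have n: "stor_node D s \<in> nodes D" using assms(1) s by (auto simp: wf_network_def)
  have LMP: "schedule_value D s LMP y = schedule_value D s (price x) y" for y
    using assms(4)[OF n] by (simp add: schedule_value_def)
  have LME: "schedule_value D s LME y = schedule_value D s (\<lambda>i t. p (Balance i t)) y
      + p Strong_duality * schedule_value D s (price x) y" for y
    using assms(5)[OF n]
    by (simp add: schedule_value_def sum_distrib_left sum.distrib[symmetric] algebra_simps)
  have cost: "schedule_value D s (price x) ?y \<le> schedule_value D s (price x) y"
    if "schedule_feasible D s y E" for y E
    using csm_schedule_cost_le_level_rent[OF assms(1) x s]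
      schedule_weak_duality[OF assms(1) x s that] by simp
  have mem: "?y \<in> cost_optimal_schedules D LMP s"
    using csm_schedule_feasible[OF x s] cost
    by (auto simp: cost_optimal_schedules_def is_arg_min_def LMP not_less)
  have "schedule_value D s LME ?y \<le> schedule_value D s LME y"
    if y: "y \<in> cost_optimal_schedules D LMP s" for y
  proof -
    from y obtain E where E: "schedule_feasible D s y E"
      by (auto simp: cost_optimal_schedules_def is_arg_min_def)
    have "schedule_value D s (price x) y = schedule_value D s (price x) ?y"
    proof (rule antisym)
      show "schedule_value D s (price x) y \<le> schedule_value D s (price x) ?y"
        using y csm_schedule_feasible[OF x s]
        by (auto simp: cost_optimal_schedules_def is_arg_min_def LMP simp flip: not_less)
    qed (rule cost[OF E])
    with balance_multiplier_optimal[OF assms(1-3) s E] show ?thesis by (simp add: LME)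
  qed
  with mem show "decentralized_optimal D LMP LME s ?y"
    by (auto simp: decentralized_optimal_def is_arg_min_def not_less)
qed

end
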